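(* Let $\mathbb{F}$ be a field of characteristic zero or larger than $d$. Let $\mu \geq w$ be positive integers and let $W \subseteq \mathbb{F}[x_1,\dots,x_k]$ be an $\mathbb{F}$-linear subspace of $k$-variate polynomials of degree at most $d$ with $\dim W \leq w$. For $\mathbf{a} \in \mathbb{F}^k$, let $H_{\mathbf{a}}$ be the $\mathbb{F}$-linear space of polynomials of degree at most $d$ which vanish with multiplicity at least $\mu$ at $\mathbf{a}$. Then for every finite set $S \subseteq \mathbb{F}$, \[\sum_{\mathbf{a} \in S^k} \dim(H_{\mathbf{a}} \cap W) \leq \frac{d w |S|^{k-1}}{\mu - w + 1}.\]
   Context: The Hasse derivative $\frac{\partial f}{\partial \mathbf{x}^{\mathbf{e}}}$ of $f \in \mathbb{F}[\mathbf{x}]$ is the coefficient of $\mathbf{z}^{\mathbf{e}}$ in $f(\mathbf{x}+\mathbf{z})$. A polynomial $f$ vanishes with multiplicity at least $\mu$ at $\mathbf{a}$ if $\frac{\partial f}{\partial\mathbf{x}^{\mathbf{e}}}(\mathbf{a}) = 0$ for all $\mathbf{e}\in\mathbb{Z}_{\geq0}^k$ with $\|\mathbf{e}\|_1 < \mu$. *)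

theory Defs
  imports Complex_Main "HOL-Library.Function_Algebras" "HOL-Library.FuncSet"
begin

text \<open>k-variate polynomials over a field are represented by their coefficient
functions c :: (nat => nat) => 'a, where a monomial is an exponent vector
m :: nat => nat supported on the variables {..<k}.\<close>

definition monomials :: "nat \<Rightarrow> (nat \<Rightarrow> nat) set" where
  "monomials k = {m. \<forall>i. k \<le> i \<longrightarrow> m i = 0}"

definition polys :: "nat \<Rightarrow> nat \<Rightarrow> ((nat \<Rightarrow> nat) \<Rightarrow> 'a::field) set" where
  "polys k d = {c. \<forall>m. c m \<noteq> 0 \<longrightarrow> m \<in> monomials k \<and> sum m {..<k} \<le> d}"

definition pscale :: "'a::field \<Rightarrow> ((nat \<Rightarrow> nat) \<Rightarrow> 'a) \<Rightarrow> ((nat \<Rightarrow> nat) \<Rightarrow> 'a)" where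
  "pscale r c = (\<lambda>m. r * c m)"

interpretation pvs: vector_space "pscale :: 'a::field \<Rightarrow> ((nat \<Rightarrow> nat) \<Rightarrow> 'a) \<Rightarrow> _"
  by unfold_locales (auto simp: pscale_def fun_eq_iff algebra_simps)

text \<open>Hasse derivative d f / d x^e evaluated at the point a: the coefficient
of z^e in f(x+z), evaluated at x = a.\<close>
definition hasse_at :: "nat \<Rightarrow> ((nat \<Rightarrow> nat) \<Rightarrow> 'a::field) \<Rightarrow> (nat \<Rightarrow> nat) \<Rightarrow> (nat \<Rightarrow> 'a) \<Rightarrow> 'a" where
  "hasse_at k c e a =
     (\<Sum>m\<in>{m. c m \<noteq> 0}. c m * (\<Prod>i<k. of_nat (m i choose e i) * a i ^ (m i - e i)))"

definition vanishes_mult :: "nat \<Rightarrow> ((nat \<Rightarrow> nat) \<Rightarrow> 'a::field) \<Rightarrow> (nat \<Rightarrow> 'a) \<Rightarrow> nat \<Rightarrow> bool" where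
  "vanishes_mult k c a \<mu> \<longleftrightarrow>
     (\<forall>e \<in> monomials k. sum e {..<k} < \<mu> \<longrightarrow> hasse_at k c e a = 0)"

definition H_space :: "nat \<Rightarrow> nat \<Rightarrow> nat \<Rightarrow> (nat \<Rightarrow> 'a::field) \<Rightarrow> ((nat \<Rightarrow> nat) \<Rightarrow> 'a) set" where
  "H_space k d \<mu> a = {c \<in> polys k d. vanishes_mult k c a \<mu>}"

end

theory Submission
  imports Defs "HOL-Library.Poly_Mapping" "Jordan_Normal_Form.Determinant"
begin

text \<open>Let \<open>n = dim W\<close> and choose \<open>f\<^sub>1, \<dots>, f\<^sub>n \<in> W\<close> with distinct leading monomials
  \<open>m\<^sub>1, \<dots>, m\<^sub>n\<close>. For every \<open>i\<close> let \<open>Q\<^sub>i\<close> be a product of \<open>n - 1\<close> Euler operators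
  \<open>x\<^sub>s \<partial>/\<partial>x\<^sub>s - m\<^sub>l(s)\<close>, one for each \<open>l \<noteq> i\<close>, where \<open>s\<close> is a coordinate in which \<open>m\<^sub>i\<close> and \<open>m\<^sub>l\<close>
  differ. Then \<open>Q\<^sub>i\<close> kills \<open>m\<^sub>l\<close> for \<open>l \<noteq> i\<close> and, by the assumption on the characteristic, not
  \<open>m\<^sub>i\<close>; hence the Wronskian-like determinant \<open>L = det (Q\<^sub>i f\<^sub>j)\<close> has a nonzero coefficient at
  \<open>m\<^sub>1 \<cdots> m\<^sub>n\<close>. Its degree is at most \<open>d n\<close>. Since \<open>Q\<^sub>i\<close> lowers multiplicities by at most \<open>n - 1\<close>,
  \<open>L\<close> vanishes at \<open>a\<close> with multiplicity at least \<open>(\<mu> - n + 1) dim (H\<^sub>a \<inter> W)\<close>. The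
  Schwartz--Zippel lemma with multiplicities, applied to \<open>L\<close>, gives the bound.\<close>

section \<open>Hasse derivatives\<close>

text \<open>The coefficient of \<open>z^e\<close> in \<open>(a + z)^m\<close>, that is, the Hasse
  derivative of a single monomial at \<open>a\<close>.\<close>

definition hcoef :: "nat \<Rightarrow> (nat \<Rightarrow> nat) \<Rightarrow> (nat \<Rightarrow> 'a::field) \<Rightarrow> (nat \<Rightarrow> nat) \<Rightarrow> 'a" where
  "hcoef k e a m = (\<Prod>i<k. of_nat (m i choose e i) * a i ^ (m i - e i))"

lemma hasse_at_eq_sum:
  assumes "finite A" "{m. c m \<noteq> 0} \<subseteq> A"
  shows "hasse_at k c e a = (\<Sum>m\<in>A. c m * hcoef k e a m)"
  unfolding hasse_at_def hcoef_def[symmetric]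
  using assms by (intro sum.mono_neutral_left) auto

lemma finite_monomials_le: "finite {m \<in> monomials k. sum m {..<k} \<le> d}"
proof (rule finite_subset)
  show "{m \<in> monomials k. sum m {..<k} \<le> d} \<subseteq>
      (\<lambda>f i. if i < k then f i else 0) ` (Pi\<^sub>E {..<k} (\<lambda>_. {..d}))"
  proof
    fix m assume m: "m \<in> {m \<in> monomials k. sum m {..<k} \<le> d}"
    have "m i \<le> d" if "i < k" for i
      using member_le_sum[of i "{..<k}" m] m that by auto
    then have "restrict m {..<k} \<in> Pi\<^sub>E {..<k} (\<lambda>_. {..d})"
      by auto
    moreover have "m = (\<lambda>i. if i < k then restrict m {..<k} i else 0)"
      using m by (auto simp: monomials_def fun_eq_iff)
    ultimately show "m \<in> (\<lambda>f i. if i < k then f i else 0) ` (Pi\<^sub>E {..<k} (\<lambda>_. {..d}))"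
      by blast
  qed
qed (intro finite_imageI finite_PiE, auto)

lemma support_polys: "c \<in> polys k d \<Longrightarrow> {m. c m \<noteq> 0} \<subseteq> {m \<in> monomials k. sum m {..<k} \<le> d}"
  by (auto simp: polys_def)

lemma finite_support_polys: "c \<in> polys k d \<Longrightarrow> finite {m. c m \<noteq> 0}"
  by (rule finite_subset[OF support_polys finite_monomials_le])

text \<open>Take \<open>e\<close> to be a monomial of maximal total degree in the support. Any other
  monomial surviving this derivative would exceed \<open>e\<close> componentwise and so have larger
  degree; what remains is the nonzero constant \<open>c e\<close>, in every characteristic.\<close>

lemma exists_hasse_at_nonzero:
  assumes c: "c \<in> polys k d" "c m0 \<noteq> 0"
  shows "\<exists>e. e \<in> monomials k \<and> hasse_at k c e a \<noteq> 0"
proof -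
  have fin: "finite {m. c m \<noteq> 0}" using finite_support_polys c by auto
  have "\<forall>n. c n \<noteq> 0 \<longrightarrow> sum n {..<k} < Suc d" using c(1) by (auto simp: polys_def)
  with c(2) have "\<exists>m. c m \<noteq> 0 \<and> (\<forall>n. c n \<noteq> 0 \<longrightarrow> sum n {..<k} \<le> sum m {..<k})"
    by (rule ex_has_greatest_nat[where P = "\<lambda>n. c n \<noteq> 0" and k = m0 and f = "\<lambda>n. sum n {..<k}" and b = "Suc d"])
  then obtain m where m: "c m \<noteq> 0"
    and max: "\<And>n. c n \<noteq> 0 \<Longrightarrow> sum n {..<k} \<le> sum m {..<k}"
    by (elim exE conjE) simp
  have mk: "m \<in> monomials k"
    using c(1) m by (simp add: polys_def)
  have other: "hcoef k m a n = 0" if n: "c n \<noteq> 0" "n \<noteq> m" for n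
  proof (rule ccontr)
    assume "hcoef k m a n \<noteq> 0"
    have le: "m i \<le> n i" if "i < k" for i
    proof (rule ccontr)
      assume "\<not> m i \<le> n i"
      then have "of_nat (n i choose m i) * a i ^ (n i - m i) = 0" by (simp add: binomial_eq_0)
      with that have "hcoef k m a n = 0"
        unfolding hcoef_def by (intro prod_zero bexI[of _ i]) simp_all
      with \<open>hcoef k m a n \<noteq> 0\<close> show False by simp
    qed
    have "n \<in> monomials k" using c(1) n(1) by (simp add: polys_def)
    moreover obtain i where i: "n i \<noteq> m i" using n(2) by auto
    ultimately have "i < k" using mk by (simp add: monomials_def) (metis not_le)
    with i have "sum m {..<k} < sum n {..<k}"
      using le by (intro sum_strict_mono_ex1) (auto intro!: bexI[of _ i] simp: le_neq_implies_less)
    with max[OF n(1)] show False by simp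
  qed
  have "hasse_at k c m a = (\<Sum>n\<in>{m}. c n * hcoef k m a n)"
    unfolding hasse_at_def hcoef_def[symmetric] using fin m other
    by (intro sum.mono_neutral_right) auto
  also have "\<dots> = c m" by (simp add: hcoef_def)
  finally show ?thesis using m mk by (intro exI[of _ m]) simp
qed

text \<open>For \<open>e < m\<close>, split \<open>m = e + (m - e)\<close> and absorb the second
  part into \<open>m choose Suc e\<close>. This expresses the Euler operator through Hasse
  derivatives of orders \<open>e\<close> and \<open>Suc e\<close> only.\<close>

lemma exponent_times_hasse_factor:
  fixes x :: "'a::field"
  shows "of_nat m * (of_nat (m choose e) * x ^ (m - e))
    = of_nat e * (of_nat (m choose e) * x ^ (m - e))
      + of_nat (Suc e) * x * (of_nat (m choose Suc e) * x ^ (m - Suc e))"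
proof (cases "e < m")
  case True
  have "m * (m choose e) = e * (m choose e) + (m - e) * (m choose e)"
    using True by (simp flip: add_mult_distrib)
  also have "(m - e) * (m choose e) = Suc e * (m choose Suc e)"
    by (simp only: binomial_absorption binomial_absorb_comp)
  finally have eq: "of_nat m * of_nat (m choose e)
      = of_nat e * of_nat (m choose e) + of_nat (Suc e) * (of_nat (m choose Suc e) :: 'a)"
    by (simp only: of_nat_mult[symmetric] of_nat_add[symmetric])
  have "x ^ (m - e) = x * x ^ (m - Suc e)"
    using True by (metis Suc_diff_Suc power_Suc)
  then show ?thesis
    using arg_cong[OF eq, of "\<lambda>z. z * x ^ (m - e)"] by (simp only: algebra_simps)
next
  case False
  then show ?thesis by (cases "e = m") (simp_all add: binomial_eq_0)
qed

lemma exponent_times_hcoef: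
  assumes "s < k"
  shows "of_nat (m s) * hcoef k e a m
    = of_nat (e s) * hcoef k e a m + of_nat (Suc (e s)) * a s * hcoef k (e(s := Suc (e s))) a m"
proof -
  let ?R = "\<Prod>i\<in>{..<k} - {s}. of_nat (m i choose e i) * a i ^ (m i - e i)"
  have 1: "hcoef k e a m = of_nat (m s choose e s) * a s ^ (m s - e s) * ?R"
    unfolding hcoef_def using assms by (subst prod.remove[of _ s]) auto
  have 2: "hcoef k (e(s := Suc (e s))) a m
      = of_nat (m s choose Suc (e s)) * a s ^ (m s - Suc (e s)) * ?R"
    unfolding hcoef_def using assms by (subst prod.remove[of _ s]) auto
  show ?thesis
    unfolding 1 2 using arg_cong[OF exponent_times_hasse_factor[of "m s" "e s" "a s"], of "\<lambda>z. z * ?R"]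
    by (simp only: algebra_simps)
qed

text \<open>Multiplying the coefficient of each monomial \<open>m\<close> by \<open>m s - x\<close> is applying the first-order
  operator \<open>x\<^sub>s \<partial>/\<partial>x\<^sub>s - x\<close>, so it costs at most one order of vanishing.\<close>

lemma vanishes_mult_euler:
  assumes fin: "finite {m. c m \<noteq> 0}" and s: "s < k" and van: "vanishes_mult k c a (Suc \<mu>)"
  shows "vanishes_mult k (\<lambda>m. (of_nat (m s) - x) * c m) a \<mu>"
  unfolding vanishes_mult_def
proof (intro ballI impI)
  fix e assume e: "e \<in> monomials k" "sum e {..<k} < \<mu>"
  let ?e = "e(s := Suc (e s))" and ?A = "{m. c m \<noteq> 0}"
  have e': "?e \<in> monomials k" using e s by (auto simp: monomials_def)
  have "sum ?e {..<k} = Suc (sum e {..<k})"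
    using s by (simp add: sum.remove[of "{..<k}" s])
  then have 0: "hasse_at k c e a = 0" "hasse_at k c ?e a = 0"
    using van e e' unfolding vanishes_mult_def by auto
  have "hasse_at k (\<lambda>m. (of_nat (m s) - x) * c m) e a
      = (\<Sum>m\<in>?A. (of_nat (m s) - x) * c m * hcoef k e a m)"
    using fin by (intro hasse_at_eq_sum) auto
  also have "\<dots> = (\<Sum>m\<in>?A. (of_nat (e s) - x) * (c m * hcoef k e a m)
      + of_nat (Suc (e s)) * a s * (c m * hcoef k ?e a m))"
  proof (intro sum.cong refl)
    fix m
    have "(of_nat (m s) - x) * c m * hcoef k e a m
        = c m * (of_nat (m s) * hcoef k e a m) - x * c m * hcoef k e a m"
      by (simp only: algebra_simps)
    also have "\<dots> = (of_nat (e s) - x) * (c m * hcoef k e a m)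
      + of_nat (Suc (e s)) * a s * (c m * hcoef k ?e a m)"
      unfolding exponent_times_hcoef[OF s] by (simp only: algebra_simps)
    finally show "(of_nat (m s) - x) * c m * hcoef k e a m
      = (of_nat (e s) - x) * (c m * hcoef k e a m)
      + of_nat (Suc (e s)) * a s * (c m * hcoef k ?e a m)" .
  qed
  also have "\<dots> = (of_nat (e s) - x) * hasse_at k c e a + of_nat (Suc (e s)) * a s * hasse_at k c ?e a"
    unfolding sum.distrib hasse_at_eq_sum[OF fin subset_refl] sum_distrib_left ..
  finally show "hasse_at k (\<lambda>m. (of_nat (m s) - x) * c m) e a = 0" by (simp add: 0)
qed

lemma vanishes_mult_euler_prod:
  assumes "finite L" "finite {m. c m \<noteq> 0}" "\<And>l. l \<in> L \<Longrightarrow> s l < k"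
    and "vanishes_mult k c a (\<mu> + card L)"
  shows "vanishes_mult k (\<lambda>m. (\<Prod>l\<in>L. of_nat (m (s l)) - x l) * c m) a \<mu>"
  using assms
proof (induction L arbitrary: \<mu> rule: finite_induct)
  case (insert l L)
  have "vanishes_mult k (\<lambda>m. (of_nat (m (s l)) - x l) * ((\<Prod>l\<in>L. of_nat (m (s l)) - x l) * c m)) a \<mu>"
  proof (rule vanishes_mult_euler)
    show "finite {m. (\<Prod>l\<in>L. of_nat (m (s l)) - x l) * c m \<noteq> 0}"
      by (rule finite_subset[OF _ insert.prems(1)]) auto
  qed (use insert in auto)
  then show ?case using insert.hyps by (simp add: mult.assoc)
qed simp

section \<open>The Schwartz--Zippel lemma with multiplicities\<close>

text \<open>\<open>N b\<close> may be zero, so \<open>S\<close> may contain points that are not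
  roots. These contribute order 0, and the orders at the roots add up to at most the degree.\<close>

lemma sum_root_multiplicities_le:
  fixes g :: "'a::field poly"
  assumes "g \<noteq> 0" "finite S" and dvd: "\<And>b. b \<in> S \<Longrightarrow> [:-b, 1:] ^ N b dvd g"
  shows "sum N S \<le> degree g"
proof -
  have "sum N S \<le> (\<Sum>b\<in>S. order b g)"
    using dvd assms(1) by (intro sum_mono) (simp add: order_divides)
  also have "\<dots> = (\<Sum>b\<in>S \<inter> {b. poly g b = 0}. order b g)"
    using assms by (intro sum.mono_neutral_right) (auto simp: order_root)
  also have "\<dots> \<le> (\<Sum>b | poly g b = 0. order b g)"
    using assms(1) by (intro sum_mono2) (auto simp: poly_roots_finite)
  also have "\<dots> \<le> degree g" by (rule sum_order_le_degree[OF assms(1)])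
  finally show ?thesis .
qed

lemma coeff_linear_power: "coeff ([:b, 1:] ^ n) j = of_nat (n choose j) * (b::'a::comm_ring_1) ^ (n - j)"
proof (cases "j \<le> n")
  case True
  then show ?thesis by (simp add: coeff_linear_poly_power)
next
  case False
  have "degree ([:b, 1:] ^ n) \<le> degree [:b, 1:] * n" by (rule degree_power_le)
  also have "\<dots> \<le> n" by simp
  finally show ?thesis using False by (simp add: coeff_eq_0 binomial_eq_0)
qed

lemma pcompose_power: "(p ^ n) \<circ>\<^sub>p q = (p \<circ>\<^sub>p q :: 'a::comm_semiring_1 poly) ^ n"
  by (induction n) (simp_all add: pcompose_mult pcompose_1)

text \<open>The substitution of \<open>x + b\<close> for \<open>x\<close> turns the claim into
  divisibility by a power of \<open>x\<close>, which is read off the coefficients; substituting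
  \<open>x - b\<close> undoes it.\<close>

lemma linear_power_dvd_if_shift_coeffs_zero:
  fixes g :: "'a::field poly"
  assumes "\<And>j. j < N \<Longrightarrow> coeff (g \<circ>\<^sub>p [:b, 1:]) j = 0"
  shows "[:-b, 1:] ^ N dvd g"
proof -
  have "monom 1 N dvd g \<circ>\<^sub>p [:b, 1:]"
    using assms by (simp add: monom_1_dvd_iff')
  then obtain h where "g \<circ>\<^sub>p [:b, 1:] = monom 1 N * h" by (elim dvdE)
  then have "(g \<circ>\<^sub>p [:b, 1:]) \<circ>\<^sub>p [:-b, 1:] = (monom 1 N * h) \<circ>\<^sub>p [:-b, 1:]" by simp
  also have "\<dots> = [:-b, 1:] ^ N * (h \<circ>\<^sub>p [:-b, 1:])"
    by (simp add: pcompose_mult monom_altdef pcompose_power pcompose_pCons)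
  finally show ?thesis
    by (simp add: pcompose_assoc[symmetric] pcompose_pCons)
qed

text \<open>The Hasse derivative of order \<open>e\<close> in the first \<open>k\<close> variables, restricted to the line over \<open>a\<close>.\<close>

definition fibre_poly :: "nat \<Rightarrow> ((nat \<Rightarrow> nat) \<Rightarrow> 'a::field) \<Rightarrow> (nat \<Rightarrow> nat) \<Rightarrow> (nat \<Rightarrow> 'a) \<Rightarrow> 'a poly" where
  "fibre_poly k c e a = (\<Sum>m | c m \<noteq> 0. monom (c m * hcoef k e a m) (m k))"

text \<open>The coefficient of the \<open>t\<close>-th power of the last variable. The guard keeps
  the support inside \<open>monomials k\<close>, since \<open>c (m(k := t))\<close> does not depend
  on \<open>m k\<close>.\<close>

definition last_var_coeff :: "nat \<Rightarrow> nat \<Rightarrow> ((nat \<Rightarrow> nat) \<Rightarrow> 'a::field) \<Rightarrow> (nat \<Rightarrow> nat) \<Rightarrow> 'a" where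
  "last_var_coeff k t c m = (if m \<in> monomials k then c (m(k := t)) else 0)"

text \<open>Hasse derivatives factor over the variables, so expanding the fibre polynomial around
  \<open>b\<close> supplies the derivative in the last variable. High multiplicity at
  \<open>a(k := b)\<close> thus becomes a high-order root at \<open>b\<close>.\<close>

lemma coeff_fibre_poly_shift:
  "coeff (fibre_poly k c e a \<circ>\<^sub>p [:b, 1:]) j = hasse_at (Suc k) c (e(k := j)) (a(k := b))"
proof -
  have 1: "monom x n \<circ>\<^sub>p [:b, 1:] = smult x ([:b, 1:] ^ n)" for x n
    by (simp add: monom_altdef pcompose_smult pcompose_power pcompose_pCons)
  have 2: "hcoef (Suc k) (e(k := j)) (a(k := b)) m
      = hcoef k e a m * (of_nat (m k choose j) * b ^ (m k - j))" for m
    by (simp add: hcoef_def)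
  show ?thesis
    unfolding fibre_poly_def hasse_at_def hcoef_def[symmetric] 2
    by (simp add: pcompose_sum 1 coeff_sum coeff_linear_power mult_ac)
qed

lemma coeff_fibre_poly:
  assumes c: "c \<in> polys (Suc k) D"
  shows "coeff (fibre_poly k c e a) t = hasse_at k (last_var_coeff k t c) e a"
proof -
  have fin: "finite {m. c m \<noteq> 0}" using finite_support_polys[OF c] .
  have [simp]: "hcoef k e a (m(k := x)) = hcoef k e a m" for m x
    by (auto simp: hcoef_def intro!: prod.cong)
  have "coeff (fibre_poly k c e a) t
      = (\<Sum>m | c m \<noteq> 0. if m k = t then c m * hcoef k e a m else 0)"
    by (simp add: fibre_poly_def coeff_sum)
  also have "\<dots> = (\<Sum>m | c m \<noteq> 0 \<and> m k = t. c m * hcoef k e a m)"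
    using fin by (simp add: sum.If_cases Int_def)
  also have "\<dots> = (\<Sum>m | last_var_coeff k t c m \<noteq> 0. last_var_coeff k t c m * hcoef k e a m)"
  proof (rule sum.reindex_bij_witness[of _ "\<lambda>m. m(k := t)" "\<lambda>m. m(k := 0)"])
    fix m assume m: "m \<in> {m. c m \<noteq> 0 \<and> m k = t}"
    then have "m \<in> monomials (Suc k)" using c by (auto simp: polys_def)
    then have mk: "m(k := 0) \<in> monomials k"
      by (auto simp: monomials_def)
    have eq: "m(k := 0, k := t) = m" using m by auto
    then show "m(k := 0, k := t) = m" .
    show "m(k := 0) \<in> {m. last_var_coeff k t c m \<noteq> 0}"
      using mk m eq by (simp add: last_var_coeff_def)
    show "last_var_coeff k t c (m(k := 0)) * hcoef k e a (m(k := 0)) = c m * hcoef k e a m"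
      using mk eq by (simp add: last_var_coeff_def)
  next
    fix m assume "m \<in> {m. last_var_coeff k t c m \<noteq> 0}"
    then have m: "m \<in> monomials k" "c (m(k := t)) \<noteq> 0"
      by (auto simp: last_var_coeff_def split: if_splits)
    then show "m(k := t, k := 0) = m" by (auto simp: monomials_def)
    show "m(k := t) \<in> {m. c m \<noteq> 0 \<and> m k = t}" using m by simp
  qed
  finally show ?thesis by (simp add: hasse_at_def hcoef_def)
qed

lemma last_var_coeff_in_polys:
  assumes c: "c \<in> polys (Suc k) D"
  shows "last_var_coeff k t c \<in> polys k (D - t)"
proof -
  have "sum m {..<k} \<le> D - t" if "c (m(k := t)) \<noteq> 0" for m
  proof -
    have "sum (m(k := t)) {..<Suc k} \<le> D" using c that by (auto simp: polys_def)
    also have "sum (m(k := t)) {..<Suc k} = sum m {..<k} + t" by simp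
    finally show ?thesis by simp
  qed
  then show ?thesis by (auto simp: polys_def last_var_coeff_def split: if_splits)
qed

text \<open>The factor \<open>card S\<close> on the left makes the bound meaningful for \<open>k = 0\<close>, where the induction starts.
  In the step, \<open>t\<close> is the degree in the last variable; over each \<open>a\<close> one differentiates with
  respect to the other variables just enough for the coefficient of degree \<open>t\<close> not to vanish
  at \<open>a\<close>.\<close>

lemma sum_multiplicities_le:
  fixes c :: "(nat \<Rightarrow> nat) \<Rightarrow> 'a::field"
  assumes "finite S" "c \<in> polys k D" "c m0 \<noteq> 0"
    and "\<And>a. a \<in> Pi\<^sub>E {..<k} (\<lambda>_. S) \<Longrightarrow> vanishes_mult k c a (M a)"
  shows "card S * (\<Sum>a\<in>Pi\<^sub>E {..<k} (\<lambda>_. S). M a) \<le> D * card S ^ k"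
  using assms(2-)
proof (induction k arbitrary: c D m0 M)
  case 0
  \<comment> \<open>The empty product has the single point \<open>\<lambda>x. undefined\<close>, and
    a nonzero constant vanishes there to order 0 only.\<close>
  have "M (\<lambda>x. undefined) = 0"
  proof (rule ccontr)
    assume "M (\<lambda>x. undefined) \<noteq> 0"
    moreover have "vanishes_mult 0 c (\<lambda>x. undefined) (M (\<lambda>x. undefined))"
      using "0.prems"(3) by auto
    ultimately show False
      using exists_hasse_at_nonzero[of c 0 D m0 "\<lambda>x. undefined"] "0.prems"(1,2)
      by (auto simp: vanishes_mult_def)
  qed
  then show ?case by simp
next
  case (Suc k)
  let ?A = "Pi\<^sub>E {..<k} (\<lambda>_. S)"
  have fin: "finite {m. c m \<noteq> 0}" using finite_support_polys[OF Suc.prems(1)] .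
  define t where "t = Max ((\<lambda>m. m k) ` {m. c m \<noteq> 0})"
  have "t \<in> (\<lambda>m. m k) ` {m. c m \<noteq> 0}"
    unfolding t_def using fin Suc.prems(2) by (intro Max_in) auto
  then obtain m1 where m1: "c m1 \<noteq> 0" "m1 k = t" by auto
  have max: "m k \<le> t" if "c m \<noteq> 0" for m
    unfolding t_def using fin that by (intro Max_ge) auto
  have m1': "m1 \<in> monomials (Suc k)" "sum m1 {..<Suc k} \<le> D"
    using Suc.prems(1) m1 by (auto simp: polys_def)
  then have tD: "t \<le> D" using m1 by simp
  define P where "P = last_var_coeff k t c"
  have P: "P \<in> polys k (D - t)"
    unfolding P_def by (rule last_var_coeff_in_polys[OF Suc.prems(1)])
  have "m1(k := 0) \<in> monomials k" using m1' by (auto simp: monomials_def)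
  moreover have "m1(k := 0, k := t) = m1" using m1 by auto
  ultimately have Pm: "P (m1(k := 0)) \<noteq> 0"
    using m1 by (simp add: P_def last_var_coeff_def)
  \<comment> \<open>An \<open>e\<close> of least total degree with nonzero derivative at
    \<open>a\<close> also certifies that \<open>P\<close> vanishes at \<open>a\<close> to order
    \<open>sum e {..<k}\<close>, so the induction hypothesis for \<open>P\<close> bounds the sum of
    these orders.\<close>
  have "\<exists>e. e \<in> monomials k \<and> hasse_at k P e a \<noteq> 0 \<and> vanishes_mult k P a (sum e {..<k})" for a
  proof -
    obtain e0 where "e0 \<in> monomials k \<and> hasse_at k P e0 a \<noteq> 0"
      using exists_hasse_at_nonzero[of P k "D - t" "m1(k := 0)" a] P Pm by blast
    from ex_has_least_nat[of "\<lambda>e. e \<in> monomials k \<and> hasse_at k P e a \<noteq> 0", OF this, of "\<lambda>e. sum e {..<k}"]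
    show ?thesis unfolding vanishes_mult_def by (meson not_le)
  qed
  then obtain e where e: "\<And>a. e a \<in> monomials k" "\<And>a. hasse_at k P (e a) a \<noteq> 0"
      "\<And>a. vanishes_mult k P a (sum (e a) {..<k})"
    by metis
  define m where "m = (\<lambda>a. sum (e a) {..<k})"
  have fibre: "(\<Sum>b\<in>S. M (a(k := b))) \<le> m a * card S + t" if a: "a \<in> ?A" for a
  proof -
    define g where "g = fibre_poly k c (e a) a"
    have "coeff g t \<noteq> 0"
      using e(2) coeff_fibre_poly[OF Suc.prems(1)] by (simp add: g_def P_def)
    then have g0: "g \<noteq> 0" by auto
    have deg: "degree g \<le> t"
    proof (rule degree_le, safe)
      fix i assume "t < i"
      then show "coeff g i = 0"
        using max by (force simp: g_def fibre_poly_def coeff_sum intro!: sum.neutral)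
    qed
    \<comment> \<open>Differentiating to order \<open>m a\<close> uses up that much of the
      multiplicity; if the truncated difference is 0, nothing is claimed.\<close>
    have "[:-b, 1:] ^ (M (a(k := b)) - m a) dvd g" if b: "b \<in> S" for b
    proof (rule linear_power_dvd_if_shift_coeffs_zero)
      fix j assume j: "j < M (a(k := b)) - m a"
      have "a(k := b) \<in> Pi\<^sub>E {..<Suc k} (\<lambda>_. S)"
        using a b by (auto simp: PiE_iff extensional_def less_Suc_eq)
      then have "vanishes_mult (Suc k) c (a(k := b)) (M (a(k := b)))"
        by (rule Suc.prems(3))
      moreover have "(e a)(k := j) \<in> monomials (Suc k)"
        using e(1)[of a] by (auto simp: monomials_def)
      moreover have "sum ((e a)(k := j)) {..<Suc k} < M (a(k := b))"
        using j by (simp add: m_def)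
      ultimately show "coeff (g \<circ>\<^sub>p [:b, 1:]) j = 0"
        unfolding g_def coeff_fibre_poly_shift vanishes_mult_def by blast
    qed
    then have "(\<Sum>b\<in>S. M (a(k := b)) - m a) \<le> t"
      using sum_root_multiplicities_le[OF g0 assms(1)] deg by fastforce
    moreover have "(\<Sum>b\<in>S. M (a(k := b))) \<le> (\<Sum>b\<in>S. m a + (M (a(k := b)) - m a))"
      by (intro sum_mono) simp
    ultimately show ?thesis by (simp add: sum.distrib mult.commute)
  qed
  have finA: "finite ?A" and cardA: "card ?A = card S ^ k"
    using assms(1) by (auto intro: finite_PiE simp: card_PiE)
  have "(\<Sum>a\<in>Pi\<^sub>E {..<Suc k} (\<lambda>_. S). M a) = (\<Sum>(b, a)\<in>S \<times> ?A. M (a(k := b)))"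
    unfolding lessThan_Suc PiE_insert_eq
    using inj_combinator[of k "{..<k}" "\<lambda>_. S"]
    by (subst sum.reindex) (simp_all add: case_prod_unfold)
  also have "\<dots> = (\<Sum>a\<in>?A. \<Sum>b\<in>S. M (a(k := b)))"
    by (simp add: sum.cartesian_product[symmetric] sum.swap[of _ S])
  also have "\<dots> \<le> (\<Sum>a\<in>?A. m a * card S + t)"
    by (intro sum_mono fibre)
  also have "\<dots> = card S * (\<Sum>a\<in>?A. m a) + t * card S ^ k"
    by (simp add: sum.distrib cardA sum_distrib_left mult.commute)
  also have "\<dots> \<le> (D - t) * card S ^ k + t * card S ^ k"
    using Suc.IH[of P "D - t" "m1(k := 0)" m, OF P Pm] e(3) unfolding m_def by simp
  also have "\<dots> = D * card S ^ k"
    using tD by (simp add: add_mult_distrib[symmetric])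
  finally show ?case by (simp add: mult.left_commute)
qed

section \<open>Multiplicities of products\<close>

text \<open>This is \<open>(a + z)^m\<close> in the ring of polynomial mappings, whose product is
  convolution; the product of plain coefficient functions is pointwise.\<close>

definition shift_monomial :: "nat \<Rightarrow> (nat \<Rightarrow> 'a::field) \<Rightarrow> (nat \<Rightarrow> nat) \<Rightarrow> ((nat \<Rightarrow> nat) \<Rightarrow>\<^sub>0 'a)" where
  "shift_monomial k a m =
     (\<Prod>i<k. (Poly_Mapping.single (0(i := 1)) 1 + Poly_Mapping.single 0 (a i)) ^ m i)"

definition taylor_shift :: "nat \<Rightarrow> (nat \<Rightarrow> 'a::field) \<Rightarrow> ((nat \<Rightarrow> nat) \<Rightarrow>\<^sub>0 'a) \<Rightarrow> ((nat \<Rightarrow> nat) \<Rightarrow>\<^sub>0 'a)" where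
  "taylor_shift k a f =
     (\<Sum>m\<in>Poly_Mapping.keys f. Poly_Mapping.single 0 (Poly_Mapping.lookup f m) * shift_monomial k a m)"

lemma shift_monomial_add: "shift_monomial k a (m + n) = shift_monomial k a m * shift_monomial k a n"
  by (simp add: shift_monomial_def power_add prod.distrib)

lemma prod_single:
  "(\<Prod>i\<in>I. Poly_Mapping.single (m i :: 'b::comm_monoid_add) (x i :: 'a::comm_semiring_1))
    = Poly_Mapping.single (sum m I) (prod x I)"
  by (induction I rule: infinite_finite_induct) (simp_all add: mult_single)

lemma single_power:
  "Poly_Mapping.single (m :: nat \<Rightarrow> nat) (x :: 'a::comm_semiring_1) ^ n
    = Poly_Mapping.single (\<lambda>j. n * m j) (x ^ n)"
  by (induction n) (simp_all add: mult_single plus_fun_def zero_fun_def[symmetric])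

text \<open>Binomial expansion in each variable, multiplied out over choice functions
  \<open>g\<close>; an exponent \<open>e\<close> arises from at most one of them.\<close>

lemma lookup_shift_monomial:
  "Poly_Mapping.lookup (shift_monomial k a m) e = (if e \<in> monomials k then hcoef k e a m else 0)"
proof -
  let ?P = "Pi\<^sub>E {..<k} (\<lambda>i. {..m i})"
  let ?x = "\<lambda>i j. of_nat (m i choose j) * a i ^ (m i - j)"
  \<comment> \<open>Choice functions are \<open>undefined\<close> outside \<open>{..<k}\<close>,
    whereas exponent vectors are 0 there.\<close>
  define ext where "ext = (\<lambda>g i. if i < k then g i else (0::nat))"
  have fin: "finite ?P" by (intro finite_PiE) auto
  have pow: "(Poly_Mapping.single (0(i := 1)) 1 + Poly_Mapping.single 0 (a i)) ^ m i
      = (\<Sum>j\<le>m i. Poly_Mapping.single (0(i := j)) (?x i j))" for i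
    by (auto simp: binomial_ring single_power of_nat_single mult_single fun_eq_iff plus_fun_def
        zero_fun_def fun_upd_def intro!: sum.cong arg_cong2[where f = Poly_Mapping.single])
  have ext: "(\<Sum>i<k. 0(i := g i)) = ext g" for g :: "nat \<Rightarrow> nat"
  proof
    fix j
    have "(\<Sum>i<k. 0(i := g i)) j = (\<Sum>i<k. (0(i := g i)) j)"
      by (induction k) auto
    also have "\<dots> = (\<Sum>i<k. if i = j then g j else 0)"
      by (intro sum.cong) auto
    finally show "(\<Sum>i<k. 0(i := g i)) j = ext g j"
      by (simp add: ext_def)
  qed
  have "shift_monomial k a m = (\<Sum>g\<in>?P. \<Prod>i<k. Poly_Mapping.single (0(i := g i)) (?x i (g i)))"
    unfolding shift_monomial_def pow by (rule prod_sum_PiE) auto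
  also have "\<dots> = (\<Sum>g\<in>?P. Poly_Mapping.single (ext g) (\<Prod>i<k. ?x i (g i)))"
    by (simp add: prod_single ext)
  finally have "Poly_Mapping.lookup (shift_monomial k a m) e
      = (\<Sum>g\<in>?P. if ext g = e then (\<Prod>i<k. ?x i (g i)) else 0)"
    by (simp add: lookup_sum lookup_single when_def)
  also have "\<dots> = (\<Sum>g | g \<in> ?P \<and> ext g = e. \<Prod>i<k. ?x i (g i))"
    using fin by (simp add: sum.If_cases Int_def)
  also have "\<dots> = (if e \<in> monomials k then hcoef k e a m else 0)"
  \<comment> \<open>If \<open>e\<close> lies in \<open>monomials k\<close> but exceeds
    \<open>m\<close> somewhere, no choice function yields it, and a zero binomial coefficient makes
    \<open>hcoef\<close> vanish as well.\<close>
  proof (cases "e \<in> monomials k \<and> (\<forall>i<k. e i \<le> m i)")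
    case True
    have "{g. g \<in> ?P \<and> ext g = e} = {restrict e {..<k}}"
    proof (intro equalityI subsetI)
      fix g assume g: "g \<in> {g. g \<in> ?P \<and> ext g = e}"
      then have "g i = restrict e {..<k} i" for i
        by (cases "i < k") (auto simp: ext_def PiE_def extensional_def)
      then show "g \<in> {restrict e {..<k}}" by auto
    next
      fix g assume "g \<in> {restrict e {..<k}}"
      then show "g \<in> {g. g \<in> ?P \<and> ext g = e}"
        using True by (auto simp: ext_def monomials_def)
    qed
    then show ?thesis using True by (simp add: hcoef_def)
  next
    case False
    have "{g. g \<in> ?P \<and> ext g = e} = {}"
      using False by (auto simp: ext_def monomials_def PiE_def Pi_def)
    moreover have "hcoef k e a m = 0" if "e \<in> monomials k"
    proof -
      obtain i where "i < k" "\<not> e i \<le> m i" using False \<open>e \<in> monomials k\<close> by auto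
      then show ?thesis
        unfolding hcoef_def by (intro prod_zero bexI[of _ i]) (simp_all add: binomial_eq_0)
    qed
    ultimately show ?thesis by (simp only: sum.empty split: if_split) simp
  qed
  finally show ?thesis .
qed

lemma taylor_shift_eq_sum:
  assumes "finite A" "Poly_Mapping.keys f \<subseteq> A"
  shows "taylor_shift k a f
    = (\<Sum>m\<in>A. Poly_Mapping.single 0 (Poly_Mapping.lookup f m) * shift_monomial k a m)"
  unfolding taylor_shift_def using assms
  by (intro sum.mono_neutral_left) (auto simp: in_keys_iff)

lemma taylor_shift_add: "taylor_shift k a (f + g) = taylor_shift k a f + taylor_shift k a g"
proof -
  let ?A = "Poly_Mapping.keys f \<union> Poly_Mapping.keys g"
  show ?thesis
    using keys_add[of f g]
    by (simp add: taylor_shift_eq_sum[of ?A] lookup_add single_add distrib_right sum.distrib)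
qed

lemma taylor_shift_zero: "taylor_shift k a 0 = 0"
  by (simp add: taylor_shift_def)

lemma taylor_shift_sum: "taylor_shift k a (sum f I) = (\<Sum>i\<in>I. taylor_shift k a (f i))"
  by (induction I rule: infinite_finite_induct) (simp_all add: taylor_shift_add taylor_shift_zero)

lemma taylor_shift_single:
  "taylor_shift k a (Poly_Mapping.single m x) = Poly_Mapping.single 0 x * shift_monomial k a m"
  by (simp add: taylor_shift_def)

lemma poly_mapping_eq_sum_single:
  "f = (\<Sum>m\<in>Poly_Mapping.keys f. Poly_Mapping.single m (Poly_Mapping.lookup f m))"
  by (rule poly_mapping_eqI)
    (auto simp: lookup_sum lookup_single when_def in_keys_iff)

text \<open>Bilinearity reduces the claim to monomials, where exponents add. Multiplicativity of the
  shift takes the place of a product rule for Hasse derivatives.\<close>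

lemma taylor_shift_mult: "taylor_shift k a (f * g) = taylor_shift k a f * taylor_shift k a g"
proof -
  let ?l = Poly_Mapping.lookup and ?s = Poly_Mapping.single
  have "f * g = (\<Sum>m\<in>Poly_Mapping.keys f. ?s m (?l f m)) * (\<Sum>n\<in>Poly_Mapping.keys g. ?s n (?l g n))"
    by (simp only: poly_mapping_eq_sum_single[symmetric])
  also have "\<dots> = (\<Sum>m\<in>Poly_Mapping.keys f. \<Sum>n\<in>Poly_Mapping.keys g. ?s (m + n) (?l f m * ?l g n))"
    by (simp add: sum_product mult_single)
  also have "taylor_shift k a \<dots> = (\<Sum>m\<in>Poly_Mapping.keys f. \<Sum>n\<in>Poly_Mapping.keys g.
      (?s 0 (?l f m) * shift_monomial k a m) * (?s 0 (?l g n) * shift_monomial k a n))"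
  proof -
    have "?s (0 :: nat \<Rightarrow> nat) (x * y) = ?s 0 x * ?s 0 y" for x y :: 'a
      by (simp add: mult_single)
    then show ?thesis
      by (simp add: taylor_shift_sum taylor_shift_single shift_monomial_add mult_ac)
  qed
  also have "\<dots> = taylor_shift k a f * taylor_shift k a g"
    by (simp add: taylor_shift_def sum_product)
  finally show ?thesis .
qed

lemma lookup_const_mult: "Poly_Mapping.lookup (Poly_Mapping.single 0 x * f) e = x * Poly_Mapping.lookup f e"
  by (simp add: mult_map_scale_conv_mult[symmetric] map.rep_eq when_def)

lemma lookup_taylor_shift:
  "Poly_Mapping.lookup (taylor_shift k a f) e
    = (if e \<in> monomials k then hasse_at k (Poly_Mapping.lookup f) e a else 0)"
  by (simp add: taylor_shift_def lookup_sum lookup_const_mult lookup_shift_monomial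
      hasse_at_eq_sum[of "Poly_Mapping.keys f"] in_keys_iff subset_iff)

text \<open>Multiplicity is measured by the total degrees of the terms of \<open>f(a + z)\<close>;
  in this form its behaviour under sums and products is read off the keys.\<close>

definition order_ge :: "nat \<Rightarrow> (nat \<Rightarrow> 'a::field) \<Rightarrow> nat \<Rightarrow> ((nat \<Rightarrow> nat) \<Rightarrow>\<^sub>0 'a) \<Rightarrow> bool" where
  "order_ge k a \<mu> f \<longleftrightarrow> (\<forall>e\<in>Poly_Mapping.keys (taylor_shift k a f). \<mu> \<le> sum e {..<k})"

lemma order_ge_iff_vanishes_mult: "order_ge k a \<mu> f \<longleftrightarrow> vanishes_mult k (Poly_Mapping.lookup f) a \<mu>"
  unfolding order_ge_def vanishes_mult_def Ball_def in_keys_iff lookup_taylor_shift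
  by (simp split: if_split) (meson not_le)

lemma order_ge_0: "order_ge k a 0 f"
  by (simp add: order_ge_def)

lemma order_ge_mult:
  assumes "order_ge k a \<mu> f" "order_ge k a \<nu> g"
  shows "order_ge k a (\<mu> + \<nu>) (f * g)"
  using assms keys_mult[of "taylor_shift k a f" "taylor_shift k a g"]
  unfolding order_ge_def taylor_shift_mult by (fastforce simp: sum.distrib intro: add_mono)

lemma order_ge_prod:
  "(\<And>i. i \<in> I \<Longrightarrow> order_ge k a (\<mu> i) (f i)) \<Longrightarrow> order_ge k a (sum \<mu> I) (prod f I)"
  by (induction I rule: infinite_finite_induct) (simp_all add: order_ge_0 order_ge_mult)

lemma order_ge_mult_left: "order_ge k a \<mu> f \<Longrightarrow> order_ge k a \<mu> (g * f)"
  using order_ge_mult[OF order_ge_0, of k a \<mu> f g] by simp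

lemma order_ge_sum:
  assumes "\<And>i. i \<in> I \<Longrightarrow> order_ge k a \<mu> (f i)"
  shows "order_ge k a \<mu> (sum f I)"
proof -
  have "order_ge k a \<mu> 0" by (simp add: order_ge_def taylor_shift_zero)
  moreover have "order_ge k a \<mu> (f + g)" if "order_ge k a \<mu> f" "order_ge k a \<mu> g" for f g
    using that keys_add[of "taylor_shift k a f" "taylor_shift k a g"]
    unfolding order_ge_def taylor_shift_add by blast
  ultimately show ?thesis using assms
    by (induction I rule: infinite_finite_induct) simp_all
qed

section \<open>Leading monomials\<close>

text \<open>The exponent of a monomial under the Kronecker substitution \<open>x\<^sub>i \<mapsto> x ^ (b ^ i)\<close>; it is
  additive, and injective on exponents smaller than \<open>b\<close>.\<close>

definition weight :: "nat \<Rightarrow> nat \<Rightarrow> (nat \<Rightarrow> nat) \<Rightarrow> nat" where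
  "weight k b m = (\<Sum>i<k. m i * b ^ i)"

lemma weight_add: "weight k b (m + n) = weight k b m + weight k b n"
  by (simp add: weight_def sum.distrib add_mult_distrib)

lemma weight_less: "(\<And>i. i < k \<Longrightarrow> m i < b) \<Longrightarrow> weight k b m < b ^ k"
proof (induction k)
  case (Suc k)
  have "weight (Suc k) b m < b ^ k + m k * b ^ k"
    using Suc.IH Suc.prems by (simp add: weight_def)
  also have "\<dots> = Suc (m k) * b ^ k" by simp
  also have "\<dots> \<le> b * b ^ k"
    using Suc.prems[of k] by (intro mult_right_mono) auto
  finally show ?case by simp
qed (simp add: weight_def)

lemma weight_inj:
  assumes "\<And>i. i < k \<Longrightarrow> m i < b" "\<And>i. i < k \<Longrightarrow> n i < b" "weight k b m = weight k b n" "i < k"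
  shows "m i = n i"
  using assms
proof (induction k)
  case (Suc k)
  have lt: "weight k b m < b ^ k" "weight k b n < b ^ k"
    using weight_less[of k m b] weight_less[of k n b] Suc.prems by auto
  have eq: "m k * b ^ k + weight k b m = n k * b ^ k + weight k b n"
    using Suc.prems(3) by (simp add: weight_def)
  have "b ^ k \<noteq> 0" using lt(1) by linarith
  \<comment> \<open>Division by \<open>b ^ k\<close> reads off the top digit, since the lower digits
    contribute less than \<open>b ^ k\<close>.\<close>
  with lt have "(m k * b ^ k + weight k b m) div b ^ k = m k" "(n k * b ^ k + weight k b n) div b ^ k = n k"
    by simp_all
  with eq have "m k = n k" by metis
  moreover from this eq have "weight k b m = weight k b n" by simp
  ultimately show ?case using Suc by (cases "i = k") auto
qed simp

lemma weight_eq_imp_eq: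
  assumes "m \<in> monomials k" "n \<in> monomials k" "sum m {..<k} \<le> d" "sum n {..<k} \<le> d"
    and "weight k (Suc d) m = weight k (Suc d) n"
  shows "m = n"
proof
  fix i
  have "m i < Suc d" "n i < Suc d" if "i < k" for i
    using member_le_sum[of i "{..<k}" m] member_le_sum[of i "{..<k}" n] assms(3,4) that by auto
  then show "m i = n i"
    using weight_inj[of k m "Suc d" n i] assms(1,2,5) by (cases "i < k") (auto simp: monomials_def)
qed

definition leading :: "('b \<Rightarrow> nat) \<Rightarrow> 'b \<Rightarrow> ('b \<Rightarrow> 'a::zero) \<Rightarrow> bool" where
  "leading v m c \<longleftrightarrow> c m \<noteq> 0 \<and> (\<forall>n. c n \<noteq> 0 \<longrightarrow> n \<noteq> m \<longrightarrow> v n < v m)"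

lemma exists_leading:
  assumes c: "c \<in> polys k d" "c m0 \<noteq> 0"
  shows "\<exists>m. leading (weight k (Suc d)) m c"
proof -
  let ?v = "weight k (Suc d)"
  have fin: "finite {m. c m \<noteq> 0}" by (rule finite_support_polys[OF c(1)])
  have "Max (?v ` {m. c m \<noteq> 0}) \<in> ?v ` {m. c m \<noteq> 0}"
    using fin c(2) by (intro Max_in) auto
  then obtain m where m: "c m \<noteq> 0" "?v m = Max (?v ` {m. c m \<noteq> 0})" by auto
  have "?v n < ?v m" if n: "c n \<noteq> 0" "n \<noteq> m" for n
  proof -
    have "?v n \<le> ?v m" unfolding m(2) using fin n by (intro Max_ge) auto
    moreover have "?v n \<noteq> ?v m"
      using weight_eq_imp_eq[of n k m d] c(1) m(1) n by (auto simp: polys_def)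
    ultimately show ?thesis by simp
  qed
  then show ?thesis using m(1) unfolding leading_def by (intro exI[of _ m]) simp
qed

text \<open>One polynomial is picked for each of the finitely many leading monomials occurring in
  \<open>W\<close>. They span \<open>W\<close> by elimination: subtracting a multiple of the
  matching one cancels the leading term and lowers the weight.\<close>

lemma exists_echelon_family:
  fixes W :: "((nat \<Rightarrow> nat) \<Rightarrow> 'a::field) set"
  assumes W: "pvs.subspace W" "W \<subseteq> polys k d"
  obtains N ms fs where "inj_on ms {..<N :: nat}"
    "\<And>j. j < N \<Longrightarrow> fs j \<in> W" "\<And>j. j < N \<Longrightarrow> leading (weight k (Suc d)) (ms j) (fs j)"
    "W \<subseteq> pvs.span (fs ` {..<N})"
proof -
  let ?v = "weight k (Suc d)"
  define L where "L = {m. \<exists>c\<in>W. leading ?v m c}"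
  have "L \<subseteq> {m \<in> monomials k. sum m {..<k} \<le> d}"
    using W(2) by (auto simp: L_def leading_def polys_def)
  then have "finite L" using finite_monomials_le finite_subset by metis
  then obtain ms where ms: "bij_betw ms {0..<card L} L"
    using ex_bij_betw_nat_finite by metis
  have "\<forall>m\<in>L. \<exists>c. c \<in> W \<and> leading ?v m c" by (auto simp: L_def)
  then obtain F where F: "\<And>m. m \<in> L \<Longrightarrow> F m \<in> W" "\<And>m. m \<in> L \<Longrightarrow> leading ?v m (F m)"
    by metis
  have span: "c \<in> pvs.span (F ` L)" if "c \<in> W" "\<forall>m. c m \<noteq> 0 \<longrightarrow> ?v m < N" for c N
    using that
  proof (induction N arbitrary: c rule: less_induct)
    case (less N)
    show ?case
    proof (cases "c = 0")
      case False
      then obtain m0 where "c m0 \<noteq> 0" by (auto simp: fun_eq_iff)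
      then obtain m where m: "leading ?v m c"
        using exists_leading[of c k d m0] less.prems(1) W(2) by blast
      then have mL: "m \<in> L" using less.prems(1) by (auto simp: L_def)
      define b where "b = pscale (c m / F m m) (F m)"
      have Fm: "F m m \<noteq> 0" using F(2)[OF mL] by (simp add: leading_def)
      have b: "b \<in> pvs.span (F ` L)"
        unfolding b_def using mL by (intro pvs.span_scale pvs.span_base) auto
      have "c - b \<in> W"
        unfolding b_def using less.prems(1) F(1)[OF mL] W(1)
        by (intro pvs.subspace_diff pvs.subspace_scale) auto
      moreover have "?v n < ?v m" if "(c - b) n \<noteq> 0" for n
      proof -
        have "n \<noteq> m" using that Fm by (auto simp: b_def pscale_def)
        moreover have "c n \<noteq> 0 \<or> F m n \<noteq> 0" using that by (auto simp: b_def pscale_def)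
        ultimately show ?thesis using m F(2)[OF mL] by (auto simp: leading_def)
      qed
      moreover have "?v m < N" using less.prems(2) m by (auto simp: leading_def)
      ultimately have "c - b \<in> pvs.span (F ` L)"
        using less.IH[of "?v m" "c - b"] by blast
      then have "(c - b) + b \<in> pvs.span (F ` L)" using b by (rule pvs.span_add)
      then show ?thesis by simp
    next
      case True
      show ?thesis unfolding True by (rule pvs.span_zero)
    qed
  qed
  show ?thesis
  proof
    show "inj_on ms {..<card L}" using ms by (simp add: bij_betw_def lessThan_atLeast0)
    have msL: "ms j \<in> L" if "j < card L" for j
      using ms that by (auto simp: bij_betw_def)
    show "F (ms j) \<in> W" if "j < card L" for j using F(1) msL[OF that] .
    show "leading ?v (ms j) (F (ms j))" if "j < card L" for j using F(2) msL[OF that] .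
    have im: "(\<lambda>j. F (ms j)) ` {..<card L} = F ` L"
      using ms by (simp add: bij_betw_def lessThan_atLeast0 image_image[symmetric])
    show "W \<subseteq> pvs.span ((\<lambda>j. F (ms j)) ` {..<card L})"
    proof
      fix c assume c: "c \<in> W"
      then have "finite {m. c m \<noteq> 0}" using W(2) finite_support_polys by blast
      then have "\<exists>N. \<forall>m. c m \<noteq> 0 \<longrightarrow> ?v m < N"
        using finite_nat_set_iff_bounded[of "?v ` {m. c m \<noteq> 0}"] by auto
      then show "c \<in> pvs.span ((\<lambda>j. F (ms j)) ` {..<card L})"
        unfolding im using span[OF c] by blast
    qed
  qed
qed

text \<open>Weaker than \<open>leading\<close>: the coefficient at \<open>m\<close> may be zero, as
  happens when an operator kills the leading term.\<close>

definition dominated :: "('b \<Rightarrow> nat) \<Rightarrow> 'b \<Rightarrow> ('b \<Rightarrow>\<^sub>0 'a::zero) \<Rightarrow> bool" where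
  "dominated v m f \<longleftrightarrow> (\<forall>n\<in>Poly_Mapping.keys f. n = m \<or> v n < v m)"

text \<open>Weights add, so among pairs of keys only \<open>(m, n)\<close> can reach the weight of
  \<open>m + n\<close>.\<close>

lemma dominated_mult:
  fixes f g :: "'b::cancel_comm_monoid_add \<Rightarrow>\<^sub>0 'a::comm_ring_1"
  assumes v: "\<And>x y. v (x + y) = v x + v y" and f: "dominated v m f" and g: "dominated v n g"
  shows "dominated v (m + n) (f * g)"
    and "Poly_Mapping.lookup (f * g) (m + n) = Poly_Mapping.lookup f m * Poly_Mapping.lookup g n"
proof -
  have less: "v (p + q) < v (m + n)"
    if "p \<in> Poly_Mapping.keys f" "q \<in> Poly_Mapping.keys g" "p \<noteq> m \<or> q \<noteq> n" for p q
    using f g that by (fastforce simp: dominated_def v)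
  show "dominated v (m + n) (f * g)"
    using keys_mult[of f g] less unfolding dominated_def by blast
  have "f * g = (\<Sum>p\<in>Poly_Mapping.keys f. \<Sum>q\<in>Poly_Mapping.keys g.
      Poly_Mapping.single (p + q) (Poly_Mapping.lookup f p * Poly_Mapping.lookup g q))"
    by (subst poly_mapping_eq_sum_single[of f], subst poly_mapping_eq_sum_single[of g])
      (simp only: sum_product mult_single)
  then have "Poly_Mapping.lookup (f * g) (m + n) = (\<Sum>p\<in>Poly_Mapping.keys f. \<Sum>q\<in>Poly_Mapping.keys g.
      if p + q = m + n then Poly_Mapping.lookup f p * Poly_Mapping.lookup g q else 0)"
    by (simp add: lookup_sum lookup_single when_def)
  also have "\<dots> = (\<Sum>p\<in>Poly_Mapping.keys f. \<Sum>q\<in>Poly_Mapping.keys g.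
      if p = m then (if q = n then Poly_Mapping.lookup f p * Poly_Mapping.lookup g q else 0) else 0)"
    by (intro sum.cong refl) (auto dest: less)
  also have "\<dots> = (\<Sum>p\<in>Poly_Mapping.keys f.
      if p = m then (\<Sum>q\<in>Poly_Mapping.keys g. if q = n then Poly_Mapping.lookup f p * Poly_Mapping.lookup g q else 0) else 0)"
    by (intro sum.cong refl) auto
  also have "\<dots> = Poly_Mapping.lookup f m * Poly_Mapping.lookup g n"
    by (auto simp: in_keys_iff)
  finally show "Poly_Mapping.lookup (f * g) (m + n) = Poly_Mapping.lookup f m * Poly_Mapping.lookup g n" .
qed

lemma lookup_prod_dominated:
  fixes f :: "'i \<Rightarrow> 'b::cancel_comm_monoid_add \<Rightarrow>\<^sub>0 'a::comm_ring_1"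
  assumes v: "\<And>x y. v (x + y) = v x + v y" and "finite I"
    and dom: "\<And>i. i \<in> I \<Longrightarrow> dominated v (m i) (f i)"
  shows "Poly_Mapping.lookup (prod f I) (sum m I) = (\<Prod>i\<in>I. Poly_Mapping.lookup (f i) (m i))"
proof -
  have "dominated v (sum m I) (prod f I) \<and>
      Poly_Mapping.lookup (prod f I) (sum m I) = (\<Prod>i\<in>I. Poly_Mapping.lookup (f i) (m i))"
    using assms(2) dom
  proof (induction I rule: finite_induct)
    case empty
    then show ?case by (simp add: dominated_def)
  next
    case (insert i I)
    then show ?case
      using dominated_mult[OF v, of "m i" "f i" "sum m I" "prod f I"] by simp
  qed
  then show ?thesis by simp
qed

section \<open>The determinant\<close>

lemma lookup_mult_in_polys:
  assumes "Poly_Mapping.lookup f \<in> polys k d" "Poly_Mapping.lookup g \<in> polys k d'"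
  shows "Poly_Mapping.lookup (f * g) \<in> polys k (d + d')"
proof -
  have "m \<in> monomials k \<and> sum m {..<k} \<le> d + d'" if "Poly_Mapping.lookup (f * g) m \<noteq> 0" for m
  proof -
    note nz = that
    obtain p q where pq: "m = p + q" "Poly_Mapping.lookup f p \<noteq> 0" "Poly_Mapping.lookup g q \<noteq> 0"
    proof -
      have "m \<in> Poly_Mapping.keys (f * g)" using nz by (simp add: in_keys_iff)
      with keys_mult[of f g] obtain p q
        where "m = p + q" "p \<in> Poly_Mapping.keys f" "q \<in> Poly_Mapping.keys g" by blast
      then show ?thesis by (intro that[of p q]) (simp_all add: in_keys_iff)
    qed
    then show ?thesis
      using assms by (auto simp: polys_def monomials_def sum.distrib intro: add_mono)
  qed
  then show ?thesis by (simp add: polys_def)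
qed

lemma lookup_prod_in_polys:
  "(\<And>i. i \<in> I \<Longrightarrow> Poly_Mapping.lookup (f i) \<in> polys k d) \<Longrightarrow>
    Poly_Mapping.lookup (prod f I) \<in> polys k (card I * d)"
proof (induction I rule: infinite_finite_induct)
  case (insert i I)
  then show ?case using lookup_mult_in_polys[of "f i" k d "prod f I" "card I * d"] by simp
qed (auto simp: polys_def monomials_def lookup_one when_def)

lemma lookup_sum_in_polys:
  assumes "\<And>i. i \<in> I \<Longrightarrow> Poly_Mapping.lookup (f i) \<in> polys k d"
  shows "Poly_Mapping.lookup (sum f I) \<in> polys k d"
proof -
  have "\<exists>i\<in>I. Poly_Mapping.lookup (f i) m \<noteq> 0" if "Poly_Mapping.lookup (sum f I) m \<noteq> 0" for m
    using that unfolding lookup_sum by (rule sum.not_neutral_contains_not_neutral) blast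
  then show ?thesis using assms unfolding polys_def by blast
qed

lemma lookup_signof_mult:
  "Poly_Mapping.lookup (signof p * f) m = signof p * (Poly_Mapping.lookup f m :: 'a::comm_ring_1)"
  by (cases "sign p = 1") (auto simp: sign_def)

text \<open>Here the hypothesis on the characteristic enters: the difference of the larger and the
  smaller number is positive and at most \<open>d\<close>, hence not a multiple of the
  characteristic.\<close>

lemma of_nat_inj_if_CHAR:
  assumes char: "CHAR('a::field) = 0 \<or> CHAR('a) > d" and "x \<le> d" "y \<le> d" "x \<noteq> y"
  shows "(of_nat x :: 'a) \<noteq> of_nat y"
proof -
  have *: "(of_nat x :: 'a) \<noteq> of_nat y" if "x < y" "y \<le> d" for x y
  proof
    assume "(of_nat x :: 'a) = of_nat y"
    then have "(of_nat (y - x) :: 'a) = 0" using that by (simp add: of_nat_diff)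
    then have "CHAR('a) dvd y - x" by (simp add: of_nat_eq_0_iff_char_dvd)
    then show False using char that by (auto dest: dvd_imp_le)
  qed
  show ?thesis
    using *[of x y] *[of y x] assms(2-) by (metis linorder_neqE_nat)
qed

text \<open>\<open>q i\<close> is the symbol of a differential operator for which all monomials are eigenvectors.\<close>

definition diff_matrix :: "nat \<Rightarrow> (nat \<Rightarrow> (nat \<Rightarrow> nat) \<Rightarrow> 'a::field) \<Rightarrow> (nat \<Rightarrow> (nat \<Rightarrow> nat) \<Rightarrow> 'a)
    \<Rightarrow> ((nat \<Rightarrow> nat) \<Rightarrow>\<^sub>0 'a) mat" where
  "diff_matrix n q f = mat n n (\<lambda>(i, j). Abs_poly_mapping (\<lambda>m. q i m * f j m))"

lemma diff_matrix_carrier [simp]: "diff_matrix n q f \<in> carrier_mat n n"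
  by (simp add: diff_matrix_def)

lemma lookup_diff_matrix:
  assumes "i < n" "j < n" "f j \<in> polys k d"
  shows "Poly_Mapping.lookup (diff_matrix n q f $$ (i, j)) = (\<lambda>m. q i m * f j m)"
proof -
  have "finite {m. q i m * f j m \<noteq> 0}"
    by (rule finite_subset[OF _ finite_support_polys[OF assms(3)]]) auto
  then show ?thesis using assms by (simp add: diff_matrix_def)
qed

lemma permutes_lt: "p permutes {0..<n::nat} \<Longrightarrow> i < n \<Longrightarrow> p i < n"
  using permutes_in_image[of p "{0..<n}" i] by simp

lemma det_diff_matrix_in_polys:
  assumes f: "\<And>j. j < n \<Longrightarrow> f j \<in> polys k d"
  shows "Poly_Mapping.lookup (det (diff_matrix n q f)) \<in> polys k (n * d)"
proof -
  have "Poly_Mapping.lookup (\<Prod>i = 0..<n. diff_matrix n q f $$ (i, p i)) \<in> polys k (card {0..<n} * d)"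
    if "p permutes {0..<n}" for p
  proof (rule lookup_prod_in_polys)
    fix i assume "i \<in> {0..<n}"
    then show "Poly_Mapping.lookup (diff_matrix n q f $$ (i, p i)) \<in> polys k d"
      using f[of "p i"] permutes_lt[OF that, of i] lookup_diff_matrix[of i n "p i" f k d q]
      by (auto simp: polys_def)
  qed
  then have "Poly_Mapping.lookup (signof p * (\<Prod>i = 0..<n. diff_matrix n q f $$ (i, p i)))
      \<in> polys k (n * d)" if "p permutes {0..<n}" for p
    using that unfolding polys_def lookup_signof_mult by auto
  then show ?thesis
    unfolding det_def'[OF diff_matrix_carrier] by (intro lookup_sum_in_polys) auto
qed

text \<open>In the Leibniz expansion the term of \<open>p\<close> contributes the product of the
  coefficients of its entries at \<open>ms (p i)\<close>. If \<open>p \<noteq> id\<close>, some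
  \<open>p i \<noteq> i\<close>, and \<open>q i\<close> kills that factor; only the diagonal term
  remains.\<close>

lemma lookup_det_diff_matrix:
  assumes f: "\<And>j. j < n \<Longrightarrow> f j \<in> polys k d" "\<And>j. j < n \<Longrightarrow> leading v (ms j) (f j)"
    and v: "\<And>x y. v (x + y) = v x + v y"
    and q: "\<And>i j. i < n \<Longrightarrow> j < n \<Longrightarrow> i \<noteq> j \<Longrightarrow> q i (ms j) = 0"
  shows "Poly_Mapping.lookup (det (diff_matrix n q f)) (\<Sum>j = 0..<n. ms j)
    = (\<Prod>j = 0..<n. q j (ms j) * f j (ms j))"
proof -
  let ?D = "diff_matrix n q f" and ?N = "\<Sum>j = 0..<n. ms j"
  have summand: "Poly_Mapping.lookup (\<Prod>i = 0..<n. ?D $$ (i, p i)) ?N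
      = (\<Prod>i = 0..<n. q i (ms (p i)) * f (p i) (ms (p i)))" if p: "p permutes {0..<n}" for p
  proof -
    \<comment> \<open>Permuting the columns does not change \<open>?N\<close>, so all Leibniz terms
      are examined at the same monomial.\<close>
    have "?N = (\<Sum>i = 0..<n. ms (p i))"
      using p by (rule sum.permute[unfolded comp_def])
    moreover have "Poly_Mapping.lookup (\<Prod>i = 0..<n. ?D $$ (i, p i)) (\<Sum>i = 0..<n. ms (p i))
        = (\<Prod>i = 0..<n. Poly_Mapping.lookup (?D $$ (i, p i)) (ms (p i)))"
    proof (rule lookup_prod_dominated[where v = v, OF v])
      fix i assume "i \<in> {0..<n}"
      then have i: "i < n" "p i < n" using permutes_lt[OF p] by auto
      show "dominated v (ms (p i)) (?D $$ (i, p i))"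
        using f(2)[OF i(2)] lookup_diff_matrix[of i n "p i" f k d q, OF i f(1)[OF i(2)]]
        by (auto simp: dominated_def leading_def in_keys_iff)
    qed simp
    moreover have "Poly_Mapping.lookup (?D $$ (i, p i)) (ms (p i)) = q i (ms (p i)) * f (p i) (ms (p i))"
      if "i < n" for i
      using lookup_diff_matrix[of i n "p i" f k d q] that permutes_lt[OF p that] f(1) by simp
    ultimately show ?thesis by simp
  qed
  have zero: "(\<Prod>i = 0..<n. q i (ms (p i)) * f (p i) (ms (p i))) = 0"
    if p: "p permutes {0..<n}" "p \<noteq> id" for p
  proof -
    obtain i where i: "p i \<noteq> i" using p(2) by (auto simp: fun_eq_iff)
    then have "i < n" using p(1) by (force simp: permutes_def)
    moreover from this have "q i (ms (p i)) = 0"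
      using i permutes_lt[OF p(1)] by (intro q) auto
    ultimately show ?thesis by (intro prod_zero) auto
  qed
  have "Poly_Mapping.lookup (det ?D) ?N
      = (\<Sum>p | p permutes {0..<n}. signof p * (\<Prod>i = 0..<n. q i (ms (p i)) * f (p i) (ms (p i))))"
    unfolding det_def'[OF diff_matrix_carrier] lookup_sum lookup_signof_mult
    using summand by (intro sum.cong) auto
  also have "\<dots> = (\<Sum>p\<in>{id}. signof p * (\<Prod>i = 0..<n. q i (ms (p i)) * f (p i) (ms (p i))))"
    using zero by (intro sum.mono_neutral_right) (auto simp: permutes_id finite_permutations)
  finally show ?thesis by simp
qed

text \<open>The bound depends on the column only, and each Leibniz term takes exactly one entry from
  each column.\<close>

lemma order_ge_det:
  assumes A: "A \<in> carrier_mat n n"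
    and ord: "\<And>i j. i < n \<Longrightarrow> j < n \<Longrightarrow> order_ge k a (\<nu> j) (A $$ (i, j))"
  shows "order_ge k a (\<Sum>j = 0..<n. \<nu> j) (det A)"
  unfolding det_def'[OF A]
proof (intro order_ge_sum order_ge_mult_left)
  fix p assume "p \<in> {p. p permutes {0..<n}}"
  then have p: "p permutes {0..<n}" by simp
  have "(\<Sum>j = 0..<n. \<nu> j) = (\<Sum>i = 0..<n. \<nu> (p i))"
    using p by (rule sum.permute[unfolded comp_def])
  moreover have "order_ge k a (\<Sum>i = 0..<n. \<nu> (p i)) (\<Prod>i = 0..<n. A $$ (i, p i))"
    using permutes_lt[OF p] by (intro order_ge_prod ord) auto
  ultimately show "order_ge k a (\<Sum>j = 0..<n. \<nu> j) (\<Prod>i = 0..<n. A $$ (i, p i))" by simp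
qed

text \<open>Entries are linear in the polynomial of their column, so linear combinations of columns
  over the field become multiplication by a matrix of constants.\<close>

lemma diff_matrix_change_of_basis:
  assumes g: "\<And>l. l < n \<Longrightarrow> g l \<in> polys k d" and f: "\<And>j. j < n \<Longrightarrow> f j \<in> polys k d"
    and fg: "\<And>j. j < n \<Longrightarrow> f j = (\<Sum>l<n. pscale (c l j) (g l))"
  shows "diff_matrix n q f = diff_matrix n q g * mat n n (\<lambda>(l, j). Poly_Mapping.single 0 (c l j))"
proof (rule eq_matI)
  fix i j assume "i < dim_row (diff_matrix n q g * mat n n (\<lambda>(l, j). Poly_Mapping.single 0 (c l j)))"
    "j < dim_col (diff_matrix n q g * mat n n (\<lambda>(l, j). Poly_Mapping.single 0 (c l j)))"
  then have ij: "i < n" "j < n" by (auto simp: diff_matrix_def)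
  have "diff_matrix n q f $$ (i, j) = (\<Sum>l<n. Poly_Mapping.single 0 (c l j) * diff_matrix n q g $$ (i, l))"
  proof (rule poly_mapping_eqI)
    fix m
    have "f j m = (\<Sum>l<n. c l j * g l m)"
      unfolding fg[OF ij(2)] by (induction n) (simp_all add: pscale_def)
    then show "Poly_Mapping.lookup (diff_matrix n q f $$ (i, j)) m
        = Poly_Mapping.lookup (\<Sum>l<n. Poly_Mapping.single 0 (c l j) * diff_matrix n q g $$ (i, l)) m"
      using ij f g
      by (simp add: lookup_sum lookup_const_mult lookup_diff_matrix[where k = k and d = d]
          sum_distrib_left mult_ac)
  qed
  then show "diff_matrix n q f $$ (i, j)
      = (diff_matrix n q g * mat n n (\<lambda>(l, j). Poly_Mapping.single 0 (c l j))) $$ (i, j)"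
    using ij by (simp add: diff_matrix_def scalar_prod_def lessThan_atLeast0 mult.commute)
qed (simp_all add: diff_matrix_def)

text \<open>Rewriting the columns in a basis of \<open>W\<close> that extends one of \<open>H\<^sub>a \<inter> W\<close> only multiplies the
  determinant by a scalar.\<close>

lemma order_ge_det_diff_matrix:
  fixes W :: "((nat \<Rightarrow> nat) \<Rightarrow> 'a::field) set"
  assumes W: "W \<subseteq> polys k d" "finite T" "W \<subseteq> pvs.span T"
    and n: "n = pvs.dim W" "n \<le> \<mu>"
    and fs: "\<And>j. j < n \<Longrightarrow> fs j \<in> W"
    and s: "\<And>i l. i < n \<Longrightarrow> l < n \<Longrightarrow> i \<noteq> l \<Longrightarrow> s i l < k"
    and q: "q = (\<lambda>i m. \<Prod>l\<in>{..<n} - {i}. of_nat (m (s i l)) - x i l)"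
  shows "order_ge k a (pvs.dim (H_space k d \<mu> a \<inter> W) * (\<mu> - n + 1)) (det (diff_matrix n q fs))"
proof -
  let ?V = "H_space k d \<mu> a \<inter> W"
  obtain B0 where B0: "B0 \<subseteq> ?V" "pvs.independent B0" "card B0 = pvs.dim ?V"
    using pvs.basis_exists[of ?V] by metis
  obtain B where B: "B0 \<subseteq> B" "B \<subseteq> W" "pvs.independent B" "W \<subseteq> pvs.span B"
    using pvs.maximal_independent_subset_extend[of B0 W] B0 by blast
  have finB: "finite B"
    using pvs.independent_span_bound[OF W(2) B(3)] B(2) W(3) by blast
  have cardB: "card B = n"
    using pvs.basis_card_eq_dim[OF B(2,4,3)] n by simp
  then obtain g where g: "bij_betw g {..<n} B"
    using ex_bij_betw_nat_finite[OF finB] by (auto simp: lessThan_atLeast0)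
  have gB: "g l \<in> B" if "l < n" for l using g that by (auto simp: bij_betw_def)
  have gW: "g l \<in> polys k d" if "l < n" for l using gB[OF that] B(2) W(1) by blast
  have "\<exists>u. fs j = (\<Sum>l<n. pscale (u l) (g l))" if "j < n" for j
  proof -
    have "fs j \<in> pvs.span B" using fs[OF that] B(4) by blast
    then obtain u where "fs j = (\<Sum>v\<in>B. pscale (u v) v)"
      unfolding pvs.span_finite[OF finB] by blast
    also have "\<dots> = (\<Sum>l<n. pscale (u (g l)) (g l))"
      using sum.reindex_bij_betw[OF g, of "\<lambda>v. pscale (u v) v"] by simp
    finally show ?thesis by (rule exI[of _ "\<lambda>l. u (g l)"])
  qed
  then obtain c where c: "\<And>j. j < n \<Longrightarrow> fs j = (\<Sum>l<n. pscale (c j l) (g l))"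
    by metis
  have eq: "diff_matrix n q fs
      = diff_matrix n q g * mat n n (\<lambda>(l, j). Poly_Mapping.single 0 (c j l))"
  proof (rule diff_matrix_change_of_basis)
    show "fs j \<in> polys k d" if "j < n" for j using fs[OF that] W(1) by blast
  qed (use gW c in auto)
  have det: "det (diff_matrix n q fs)
      = det (mat n n (\<lambda>(l, j). Poly_Mapping.single 0 (c j l))) * det (diff_matrix n q g)"
    unfolding eq by (subst det_mult[of _ n]) (simp_all add: mult.commute)
  \<comment> \<open>Only columns that come from the basis of \<open>?V\<close> are forced to vanish
    at \<open>a\<close>.\<close>
  define \<nu> where "\<nu> = (\<lambda>j. if g j \<in> B0 then \<mu> - n + 1 else 0)"
  have "order_ge k a (\<Sum>j = 0..<n. \<nu> j) (det (diff_matrix n q g))"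
  proof (rule order_ge_det[OF diff_matrix_carrier])
    fix i j assume ij: "i < n" "j < n"
    show "order_ge k a (\<nu> j) (diff_matrix n q g $$ (i, j))"
    proof (cases "g j \<in> B0")
      case True
      have "vanishes_mult k (\<lambda>m. (\<Prod>l\<in>{..<n} - {i}. of_nat (m (s i l)) - x i l) * g j m) a (\<mu> - n + 1)"
      proof (rule vanishes_mult_euler_prod)
        show "finite {m. g j m \<noteq> 0}" by (rule finite_support_polys[OF gW[OF ij(2)]])
        \<comment> \<open>The operator has \<open>n - 1\<close> factors, and
          \<open>n \<le> \<mu>\<close> keeps the truncated subtraction exact.\<close>
        have "\<mu> - n + 1 + card ({..<n} - {i}) = \<mu>" using ij n(2) by simp
        moreover have "vanishes_mult k (g j) a \<mu>" using True B0(1) by (auto simp: H_space_def)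
        ultimately show "vanishes_mult k (g j) a (\<mu> - n + 1 + card ({..<n} - {i}))" by simp
      qed (use s ij in auto)
      then show ?thesis
        using True lookup_diff_matrix[of i n j g k d q] ij gW
        by (simp add: order_ge_iff_vanishes_mult \<nu>_def q)
    qed (simp add: \<nu>_def order_ge_0)
  qed
  moreover have "(\<Sum>j = 0..<n. \<nu> j) = pvs.dim ?V * (\<mu> - n + 1)"
  proof -
    have "(\<Sum>j = 0..<n. \<nu> j) = (\<Sum>j<n. if g j \<in> B0 then \<mu> - n + 1 else 0)"
      by (simp add: \<nu>_def lessThan_atLeast0)
    also have "\<dots> = (\<Sum>v\<in>B. if v \<in> B0 then \<mu> - n + 1 else 0)"
      by (rule sum.reindex_bij_betw[OF g])
    also have "\<dots> = card B0 * (\<mu> - n + 1)"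
      using finB B(1) by (simp add: sum.If_cases Int_absorb1)
    finally show ?thesis using B0(3) by simp
  qed
  ultimately show ?thesis unfolding det by (intro order_ge_mult_left) simp
qed

section \<open>From the determinant to the sum of dimensions\<close>

lemma sum_dim_H_space_le:
  fixes W :: "((nat \<Rightarrow> nat) \<Rightarrow> 'a::field) set"
  assumes char: "CHAR('a) = 0 \<or> CHAR('a) > d"
    and W: "pvs.subspace W" "W \<subseteq> polys k d" "pvs.dim W \<le> \<mu>"
    and S: "finite S"
  shows "card S * ((\<Sum>a\<in>Pi\<^sub>E {..<k} (\<lambda>_. S). pvs.dim (H_space k d \<mu> a \<inter> W)) * (\<mu> - pvs.dim W + 1))
    \<le> pvs.dim W * d * card S ^ k"
proof -
  let ?v = "weight k (Suc d)"
  obtain N ms fs where ms: "inj_on ms {..<N :: nat}"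
    and fs: "\<And>j. j < N \<Longrightarrow> fs j \<in> W" "\<And>j. j < N \<Longrightarrow> leading ?v (ms j) (fs j)"
    and span: "W \<subseteq> pvs.span (fs ` {..<N})"
    by (rule exists_echelon_family[OF W(1,2)]) blast
  define n where "n = pvs.dim W"
  \<comment> \<open>The family spans \<open>W\<close>, so it has at least \<open>n\<close> members;
    its first \<open>n\<close> give the columns of the determinant.\<close>
  have "n \<le> card (fs ` {..<N})"
    unfolding n_def using span by (intro pvs.dim_le_card) auto
  also have "\<dots> \<le> N" using card_image_le[of "{..<N}" fs] by simp
  finally have nN: "n \<le> N" .
  have mem: "ms j \<in> monomials k \<and> sum (ms j) {..<k} \<le> d" if "j < n" for j
    using fs[of j] W(2) that nN by (auto simp: leading_def polys_def)
  have "\<exists>i<k. ms j i \<noteq> ms l i" if "j < n" "l < n" "j \<noteq> l" for j l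
  proof -
    have "ms j \<noteq> ms l" using ms that nN by (auto simp: inj_on_def)
    then obtain i where i: "ms j i \<noteq> ms l i" by auto
    then have "i < k" using mem[OF that(1)] mem[OF that(2)]
      by (cases "i < k") (auto simp: monomials_def)
    with i show ?thesis by blast
  qed
  then obtain s where s: "\<And>j l. j < n \<Longrightarrow> l < n \<Longrightarrow> j \<noteq> l \<Longrightarrow> s j l < k \<and> ms j (s j l) \<noteq> ms l (s j l)"
    by metis
  \<comment> \<open>The factor for \<open>l\<close> vanishes at \<open>ms l\<close>, which clears
    everything off the diagonal; at \<open>ms i\<close> it is a difference of distinct exponents,
    both at most \<open>d\<close>.\<close>
  define q :: "nat \<Rightarrow> (nat \<Rightarrow> nat) \<Rightarrow> 'a"
    where "q = (\<lambda>i m. \<Prod>l\<in>{..<n} - {i}. of_nat (m (s i l)) - of_nat (ms l (s i l)))"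
  define L where "L = det (diff_matrix n q fs)"
  have poly: "fs j \<in> polys k d" if "j < n" for j
    using fs(1)[of j] W(2) that nN by auto
  have deg: "Poly_Mapping.lookup L \<in> polys k (n * d)"
    unfolding L_def by (rule det_diff_matrix_in_polys[OF poly])
  have "Poly_Mapping.lookup L (\<Sum>j = 0..<n. ms j) = (\<Prod>j = 0..<n. q j (ms j) * fs j (ms j))"
    unfolding L_def
  proof (rule lookup_det_diff_matrix[OF poly _ weight_add])
    show "leading ?v (ms j) (fs j)" if "j < n" for j using fs(2) that nN by simp
    show "q i (ms j) = 0" if "i < n" "j < n" "i \<noteq> j" for i j
      unfolding q_def using that by (intro prod_zero bexI[of _ j]) auto
  qed
  moreover have "q j (ms j) * fs j (ms j) \<noteq> 0" if "j < n" for j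
  proof -
    have "of_nat (ms j (s j l)) - of_nat (ms l (s j l)) \<noteq> (0 :: 'a)" if l: "l < n" "l \<noteq> j" for l
    proof -
      have "ms j (s j l) \<le> d" "ms l (s j l) \<le> d"
        using mem[OF \<open>j < n\<close>] mem[OF l(1)] s[OF \<open>j < n\<close> l(1)] l(2)
          member_le_sum[of "s j l" "{..<k}" "ms j"] member_le_sum[of "s j l" "{..<k}" "ms l"] by auto
      then show ?thesis
        using of_nat_inj_if_CHAR[OF char] s[OF \<open>j < n\<close> l(1)] l(2) by auto
    qed
    then have "q j (ms j) \<noteq> 0" by (auto simp: q_def)
    moreover have "fs j (ms j) \<noteq> 0" using fs(2)[of j] that nN by (simp add: leading_def)
    ultimately show ?thesis by simp
  qed
  ultimately have nz: "Poly_Mapping.lookup L (\<Sum>j = 0..<n. ms j) \<noteq> 0" by simp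
  have "vanishes_mult k (Poly_Mapping.lookup L) a (pvs.dim (H_space k d \<mu> a \<inter> W) * (\<mu> - n + 1))" for a
    unfolding order_ge_iff_vanishes_mult[symmetric] L_def
    by (rule order_ge_det_diff_matrix[OF W(2) _ span n_def _ _ _ q_def])
      (use W(3) fs(1) nN s in \<open>auto simp: n_def\<close>)
  from sum_multiplicities_le[OF S deg nz this]
  show ?thesis by (simp only: sum_distrib_right n_def)
qed

theorem theorem5p1:
  fixes W :: "((nat \<Rightarrow> nat) \<Rightarrow> 'a::field) set"
    and S :: "'a set"
    and k d \<mu> w :: nat
  assumes char: "CHAR('a) = 0 \<or> CHAR('a) > d"
    and pos: "0 < w" "w \<le> \<mu>"
    and Wsub: "pvs.subspace W"
    and Wdeg: "W \<subseteq> polys k d"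
    and Wdim: "pvs.dim W \<le> w"
    and S: "finite S"
  shows "(\<Sum>a\<in>Pi\<^sub>E {..<k} (\<lambda>_. S). real (pvs.dim (H_space k d \<mu> a \<inter> W)))
           \<le> real d * real w * real (card S) powi (int k - 1) / real (\<mu> - w + 1)"
proof (cases k)
  case 0
  \<comment> \<open>For \<open>k = 0\<close> the exponent is -1 and the right-hand side is 0 when
    \<open>S\<close> is empty. The left-hand side is therefore shown to be 0: a nonzero constant
    does not vanish to order \<open>\<mu> > 0\<close>.\<close>
  have "c = 0" if "c \<in> H_space k d \<mu> a" for c :: "(nat \<Rightarrow> nat) \<Rightarrow> 'a" and a
  proof (rule ccontr)
    assume "c \<noteq> 0"
    then obtain m0 where "c m0 \<noteq> 0" by (auto simp: fun_eq_iff)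
    moreover have "c \<in> polys k d" "vanishes_mult k c a \<mu>"
      using that by (auto simp: H_space_def)
    ultimately show False
      using exists_hasse_at_nonzero[of c k d m0 a] pos 0 by (auto simp: vanishes_mult_def)
  qed
  then have "H_space k d \<mu> a \<inter> W \<subseteq> pvs.span {}" for a
    by (auto simp: pvs.span_empty)
  then have "pvs.dim (H_space k d \<mu> a \<inter> W) = 0" for a
    using pvs.dim_le_card[of "H_space k d \<mu> a \<inter> W" "{}"] by simp
  then show ?thesis by simp
next
  case (Suc k')
  let ?D = "\<Sum>a\<in>Pi\<^sub>E {..<k} (\<lambda>_. S). pvs.dim (H_space k d \<mu> a \<inter> W)"
  \<comment> \<open>The factor \<open>card S\<close> can be cancelled only if it is positive; for
    empty \<open>S\<close> there are no points to sum over, since \<open>k > 0\<close>.\<close>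
  have "?D * (\<mu> - w + 1) \<le> d * w * card S ^ k'"
  proof (cases "S = {}")
    case True
    then have "Pi\<^sub>E {..<k} (\<lambda>_. S) = {}" using Suc by (auto simp: PiE_eq_empty_iff)
    then show ?thesis by simp
  next
    case False
    then have pos_S: "card S > 0" using S by (simp add: card_gt_0_iff)
    \<comment> \<open>Replacing \<open>pvs.dim W\<close> by \<open>w\<close> shrinks the factor on
      the left and enlarges the bound on the right.\<close>
    have "card S * (?D * (\<mu> - w + 1)) \<le> card S * (?D * (\<mu> - pvs.dim W + 1))"
      using Wdim by (intro mult_left_mono) auto
    also have "\<dots> \<le> pvs.dim W * d * card S ^ k"
      using Wdim pos by (intro sum_dim_H_space_le char Wsub Wdeg S) simp
    also have "\<dots> \<le> w * d * card S ^ k"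
      using Wdim by (intro mult_right_mono) auto
    also have "\<dots> = card S * (d * w * card S ^ k')" by (simp add: Suc)
    finally show ?thesis using pos_S by simp
  qed
  then have "real (?D * (\<mu> - w + 1)) \<le> real (d * w * card S ^ k')"
    by (rule of_nat_mono)
  moreover have "real (card S) powi (int k - 1) = real (card S) ^ k'"
    by (simp add: Suc)
  ultimately show ?thesis
    by (simp add: pos_le_divide_eq distrib_left)
qed

end
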